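(* Let $X \subseteq \mathcal A^{\mathbb Z}$ be a minimal subshift. If there exists a non-empty word $u \in \mathcal L(X)$ such that the set of integer linear combinations of elements of $\vec{\mathcal R}_X(u)$ is a finite index subgroup of $\mathbb Z^{\mathcal A}$, then every letter-coboundary in $X$ is trivial.
   Context: A subshift is a closed set $X\subseteq\mathcal A^{\mathbb Z}$ ($\mathcal A$ a finite alphabet) with $S(X)=X$, $S$ the shift map; it is minimal if every orbit is dense. $\mathcal L(X)$ is the set of finite words occurring in points of $X$. For a non-empty word $u\in\mathcal L(X)$, a return word to $u$ in $X$ is a word $w\in\mathcal A^*$ such that $wu\in\mathcal L(X)$ and $wu$ contains exactly two occurrences of $u$, one as a prefix and one as a suffix; $\mathcal R_X(u)$ is the set of these. The Parikh vector $\vec w\in\mathbb Z^{\mathcal A}$ of a word $w$ has as $a$-th coordinate the number of occurrences of $a$ in $w$, and $\vec{\mathcal R}_X(u)=\{\vec w:w\in\mathcal R_X(u)\}$. A letter-coboundary in $X$ is a monoid morphism $c:\mathcal A^*\to(\mathbb R,+)$ such that $c(w)=0$ for every letter $a$ and every return word $w$ to $a$ in $X$; it is trivial if $c(a)=0$ for all $a\in\mathcal A$. *)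

theory Defs
  imports "HOL-Analysis.Analysis" "HOL-Library.Sublist" "HOL-Algebra.Coset"
begin

text \<open>The finite alphabet is a type \<open>'a::finite\<close>, and \<open>int \<Rightarrow> 'a\<close> is the set of bi-infinite sequences,
  with the product of the discrete topologies.\<close>

definition full_shift :: "(int \<Rightarrow> 'a::finite) topology" where
  "full_shift = product_topology (\<lambda>_. discrete_topology UNIV) UNIV"

definition shift :: "(int \<Rightarrow> 'a) \<Rightarrow> int \<Rightarrow> 'a" where
  "shift x = (\<lambda>i. x (i + 1))"

definition subshift :: "(int \<Rightarrow> 'a::finite) set \<Rightarrow> bool" where
  "subshift X \<longleftrightarrow> closedin full_shift X \<and> shift ` X = X"

text \<open>The two-sided orbit: \<open>\<lambda>i. x (i + n)\<close> is the \<open>n\<close>-th iterate of the shift at \<open>x\<close>,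
  for \<open>n\<close> of either sign.\<close>

definition orbit :: "(int \<Rightarrow> 'a) \<Rightarrow> (int \<Rightarrow> 'a) set" where
  "orbit x = range (\<lambda>(n::int) i. x (i + n))"

definition minimal_subshift :: "(int \<Rightarrow> 'a::finite) set \<Rightarrow> bool" where
  "minimal_subshift X \<longleftrightarrow> subshift X \<and>
     (\<forall>x\<in>X. subtopology full_shift X closure_of orbit x = X)"

definition lang :: "(int \<Rightarrow> 'a) set \<Rightarrow> 'a list set" where
  "lang X = {w. \<exists>x\<in>X. \<exists>i. \<forall>k<length w. w ! k = x (i + int k)}"

definition occurrences :: "'a list \<Rightarrow> 'a list \<Rightarrow> nat set" where
  "occurrences u v = {i. i + length u \<le> length v \<and> take (length u) (drop i v) = u}"

text \<open>For non-empty \<open>u\<close>, the cardinality condition excludes the empty word as a return word.\<close>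

definition return_words :: "(int \<Rightarrow> 'a) set \<Rightarrow> 'a list \<Rightarrow> 'a list set" where
  "return_words X u = {w. w @ u \<in> lang X \<and> card (occurrences u (w @ u)) = 2 \<and>
     prefix u (w @ u) \<and> suffix u (w @ u)}"

definition parikh :: "'a::finite list \<Rightarrow> int ^ 'a" where
  "parikh w = (\<chi> a. int (count_list w a))"

definition int_combinations :: "(int ^ 'a::finite) set \<Rightarrow> (int ^ 'a) set" where
  "int_combinations S = {(\<Sum>v\<in>F. r v *s v) | F r. finite F \<and> F \<subseteq> S}"

definition int_lattice :: "(int ^ 'a::finite) monoid" where
  "int_lattice = \<lparr>carrier = UNIV, monoid.mult = (+), one = 0\<rparr>"

definition finite_index_subgroup :: "'g set \<Rightarrow> ('g, 'm) monoid_scheme \<Rightarrow> bool" where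
  "finite_index_subgroup H G \<longleftrightarrow> subgroup H G \<and> finite (rcosets\<^bsub>G\<^esub> H)"

definition letter_coboundary :: "(int \<Rightarrow> 'a) set \<Rightarrow> ('a list \<Rightarrow> real) \<Rightarrow> bool" where
  "letter_coboundary X c \<longleftrightarrow> c [] = 0 \<and> (\<forall>u v. c (u @ v) = c u + c v) \<and>
     (\<forall>a. \<forall>w\<in>return_words X [a]. c w = 0)"

definition trivial_coboundary :: "('a list \<Rightarrow> real) \<Rightarrow> bool" where
  "trivial_coboundary c \<longleftrightarrow> (\<forall>a. c [a] = 0)"

end

theory Submission
  imports Defs
begin

text \<open>
  A return word \<open>w\<close> to \<open>u\<close> starts with the first letter \<open>a\<close> of \<open>u\<close>, and \<open>w\<close> followed by \<open>a\<close> is a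
  prefix of \<open>w @ u\<close>, hence a word of the language. Cutting \<open>w\<close> before each occurrence of \<open>a\<close> writes
  it as a concatenation of return words to \<open>a\<close>, so a letter-coboundary vanishes on every return word
  to every non-empty word (\<open>letter_coboundary_return_word\<close>).

  A letter-coboundary \<open>c\<close> factors through the Parikh vector: it is the restriction to words of the
  additive functional \<open>coboundary_functional c\<close> on \<open>\<int>\<^sup>A\<close>. That functional therefore
  vanishes on the subgroup generated by the Parikh vectors of the return words to \<open>u\<close>. Since its
  values lie in the torsion-free group of the reals, it cannot vanish on a subgroup of finite index
  without vanishing everywhere (\<open>additive_zero_on_finite_index\<close>).
\<close>

lemma lang_appendD1:
  assumes "u @ v \<in> lang X"
  shows "u \<in> lang X"
proof -
  from assms obtain x i where x: "x \<in> X"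
    and uv: "\<And>k. k < length (u @ v) \<Longrightarrow> (u @ v) ! k = x (i + int k)"
    unfolding lang_def by blast
  have "u ! k = x (i + int k)" if "k < length u" for k
    using uv[of k] that by (simp add: nth_append)
  with x show ?thesis
    unfolding lang_def by blast
qed

lemma lang_appendD2:
  assumes "u @ v \<in> lang X"
  shows "v \<in> lang X"
proof -
  from assms obtain x i where x: "x \<in> X"
    and uv: "\<And>k. k < length (u @ v) \<Longrightarrow> (u @ v) ! k = x (i + int k)"
    unfolding lang_def by blast
  have "v ! k = x (i + int (length u) + int k)" if "k < length v" for k
    using uv[of "length u + k"] that by (simp add: algebra_simps nth_append)
  with x show ?thesis
    unfolding lang_def by blast
qed

lemma occurrences_singleton: "occurrences [a] v = {i. i < length v \<and> v ! i = a}"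
  unfolding occurrences_def
  by (auto simp: Suc_le_eq take_Suc_conv_app_nth hd_drop_conv_nth take_Suc)

lemma return_word_to_letterI:
  assumes "a \<notin> set p" and "a # p @ [a] \<in> lang X"
  shows "a # p \<in> return_words X [a]"
proof -
  have "i < length (a # p @ [a]) \<and> (a # p @ [a]) ! i = a \<longleftrightarrow> i = 0 \<or> i = Suc (length p)" for i
  proof (cases i)
    case (Suc j)
    have "p ! j \<noteq> a" if "j < length p"
      using assms(1) that nth_mem by blast
    with Suc show ?thesis
      by (cases "j = length p") (auto simp: nth_append less_Suc_eq)
  qed simp
  then have "occurrences [a] ((a # p) @ [a]) = {0, Suc (length p)}"
    unfolding occurrences_singleton append_Cons by blast
  then show ?thesis
    using assms(2) by (simp add: return_words_def suffix_def)
qed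

text \<open>A word that starts with \<open>a\<close> and is followed by \<open>a\<close> is a concatenation of return words to \<open>a\<close>;
  the induction splits off the first of them.\<close>

lemma letter_coboundary_between_occurrences:
  assumes c: "letter_coboundary X c"
  shows "a # w @ [a] \<in> lang X \<Longrightarrow> c (a # w) = 0"
proof (induction w rule: length_induct)
  case (1 w)
  show ?case
  proof (cases "a \<in> set w")
    case False
    then have "a # w \<in> return_words X [a]"
      using "1.prems" by (rule return_word_to_letterI)
    with c show ?thesis
      unfolding letter_coboundary_def by blast
  next
    case True
    then obtain p q where w: "w = p @ a # q" and p: "a \<notin> set p"
      by (meson split_list_first)
    have "a # p @ [a] \<in> lang X"
      using 1(2) lang_appendD1[of "a # p @ [a]" "q @ [a]"] by (simp add: w)
    with p have "a # p \<in> return_words X [a]"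
      by (rule return_word_to_letterI)
    then have "c (a # p) = 0"
      using c unfolding letter_coboundary_def by blast
    moreover have "a # q @ [a] \<in> lang X"
      using 1(2) lang_appendD2[of "a # p"] by (simp add: w)
    then have "c (a # q) = 0"
      using 1(1) by (simp add: w)
    moreover have "c (a # w) = c (a # p) + c (a # q)"
      using c unfolding letter_coboundary_def w by (metis append_Cons)
    ultimately show ?thesis by simp
  qed
qed

lemma return_word_not_Nil:
  assumes "w \<in> return_words X u"
  shows "w \<noteq> []"
proof
  assume "w = []"
  then have "occurrences u (w @ u) = {0}"
    by (auto simp: occurrences_def)
  with assms show False
    by (simp add: return_words_def)
qed

lemma letter_coboundary_return_word:
  assumes c: "letter_coboundary X c" and "u \<noteq> []" and w: "w \<in> return_words X u"
  shows "c w = 0"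
proof -
  obtain a u' where u: "u = a # u'"
    using \<open>u \<noteq> []\<close> by (cases u) auto
  obtain b w' where w': "w = b # w'"
    using return_word_not_Nil[OF w] by (cases w) auto
  have "b = a"
    using w unfolding return_words_def u w' by simp
  moreover have "a # w' @ [a] \<in> lang X"
    using w \<open>b = a\<close> lang_appendD1[of "a # w' @ [a]" u'] by (simp add: return_words_def u w')
  ultimately show ?thesis
    using letter_coboundary_between_occurrences[OF c] w' by simp
qed

definition coboundary_functional :: "('a::finite list \<Rightarrow> real) \<Rightarrow> int ^ 'a \<Rightarrow> real" where
  "coboundary_functional c v = (\<Sum>a\<in>UNIV. of_int (v $ a) * c [a])"

lemma coboundary_functional_add:
  "coboundary_functional c (v + w) = coboundary_functional c v + coboundary_functional c w"
  by (simp add: coboundary_functional_def algebra_simps sum.distrib)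

lemma coboundary_functional_scale:
  "coboundary_functional c (k *s v) = of_int k * coboundary_functional c v"
  by (simp add: coboundary_functional_def sum_distrib_left algebra_simps)

lemma coboundary_functional_axis: "coboundary_functional c (axis a 1) = c [a]"
proof -
  have "of_int (axis a 1 $ b) * c [b] = (if b = a then c [b] else 0)" for b
    by (simp add: axis_def)
  then show ?thesis
    by (simp add: coboundary_functional_def)
qed

lemma coboundary_functional_parikh:
  assumes "letter_coboundary X c"
  shows "coboundary_functional c (parikh w) = c w"
proof (induction w)
  case Nil
  then show ?case
    using assms by (simp add: coboundary_functional_def parikh_def letter_coboundary_def)
next
  case (Cons b w)
  have "parikh (b # w) = axis b 1 + parikh w"
    by (simp add: vec_eq_iff parikh_def axis_def)
  then have "coboundary_functional c (parikh (b # w)) = c [b] + c w"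
    by (simp add: coboundary_functional_add coboundary_functional_axis Cons.IH)
  also have "\<dots> = c (b # w)"
    using assms unfolding letter_coboundary_def by (metis append_Cons append_Nil)
  finally show ?case .
qed

lemma coboundary_functional_zero_on_combinations:
  assumes "\<And>v. v \<in> S \<Longrightarrow> coboundary_functional c v = 0" and "h \<in> int_combinations S"
  shows "coboundary_functional c h = 0"
proof -
  obtain F r where h: "h = (\<Sum>v\<in>F. r v *s v)" and "finite F" "F \<subseteq> S"
    using assms(2) unfolding int_combinations_def by blast
  from \<open>finite F\<close> \<open>F \<subseteq> S\<close> have "coboundary_functional c (\<Sum>v\<in>F. r v *s v) = 0"
  proof (induction F rule: finite_induct)
    case empty
    then show ?case by (simp add: coboundary_functional_def)
  next
    case (insert v F)
    then show ?case
      by (simp add: coboundary_functional_add coboundary_functional_scale assms(1))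
  qed
  with h show ?thesis by simp
qed

text \<open>With only finitely many cosets, \<open>k *s v\<close> and \<open>l *s v\<close> lie in the same coset of \<open>H\<close> for some
  \<open>k \<noteq> l\<close> and so have the same image; as the reals have no torsion, the image of \<open>v\<close> is zero.\<close>

lemma additive_zero_on_finite_index:
  fixes f :: "int ^ 'a::finite \<Rightarrow> real"
  assumes add: "\<And>v w. f (v + w) = f v + f w"
    and scale: "\<And>k v. f (k *s v) = of_int k * f v"
    and zero: "\<And>h. h \<in> H \<Longrightarrow> f h = 0"
    and H: "finite_index_subgroup H int_lattice"
  shows "f v = 0"
proof -
  define coset where "coset k = H #>\<^bsub>int_lattice\<^esub> (k *s v)" for k :: int
  have "range coset \<subseteq> rcosets\<^bsub>int_lattice\<^esub> H"
    by (auto simp: coset_def RCOSETS_def int_lattice_def)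
  then have "finite (range coset)"
    using H finite_subset unfolding finite_index_subgroup_def by blast
  then have "\<not> inj coset"
    using finite_imageD infinite_UNIV_int by blast
  then obtain k l where "k \<noteq> l" and kl: "coset k = coset l"
    by (auto simp: inj_def)
  have "0 \<in> H"
    using H subgroup.one_closed unfolding finite_index_subgroup_def int_lattice_def by fastforce
  then have "k *s v \<in> coset k"
    unfolding coset_def r_coset_def int_lattice_def by force
  then obtain h where "h \<in> H" and "k *s v = h + l *s v"
    unfolding kl unfolding coset_def r_coset_def int_lattice_def by auto
  then have "of_int k * f v = of_int l * f v"
    by (metis add scale zero add_0)
  with \<open>k \<noteq> l\<close> show ?thesis by simp
qed

theorem proposition6p14:
  fixes X :: "(int \<Rightarrow> 'a::finite) set"
  assumes "minimal_subshift X"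
    and "\<exists>u. u \<noteq> [] \<and> u \<in> lang X \<and>
           finite_index_subgroup (int_combinations (parikh ` return_words X u)) int_lattice"
  shows "\<forall>c. letter_coboundary X c \<longrightarrow> trivial_coboundary c"
proof (intro allI impI)
  fix c assume c: "letter_coboundary X c"
  obtain u where "u \<noteq> []" and
    index: "finite_index_subgroup (int_combinations (parikh ` return_words X u)) int_lattice"
    using assms(2) by blast
  have "coboundary_functional c v = 0" if "v \<in> parikh ` return_words X u" for v
    using that letter_coboundary_return_word[OF c \<open>u \<noteq> []\<close>] coboundary_functional_parikh[OF c]
    by auto
  then have "coboundary_functional c h = 0"
    if "h \<in> int_combinations (parikh ` return_words X u)" for h
    using that coboundary_functional_zero_on_combinations by blast
  then have "coboundary_functional c v = 0" for v
    by (rule additive_zero_on_finite_index[OF coboundary_functional_add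
          coboundary_functional_scale _ index])
  then show "trivial_coboundary c"
    unfolding trivial_coboundary_def by (metis coboundary_functional_axis)
qed

end
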